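(* Let $\mathcal{O}$ be the split Okubo algebra over a field $\mathbb{F}$ with $\operatorname{char}\mathbb{F}=3$. Then all shortest paths in the orthogonality graph $\Gamma_O(\mathcal{O})$ are unique; that is, any two vertices at finite distance $k$ are joined by exactly one path of length $k$.
   Context: The split Okubo algebra over a field $\mathbb{F}$ is the $8$-dimensional $\mathbb{F}$-algebra $\mathcal{O}=\mathcal{O}_{1,1}$ with basis $z_{1,0},z_{2,0},z_{0,1},z_{0,2},z_{1,1},z_{2,2},z_{1,2},z_{2,1}$ and (bilinear, non-associative) multiplication $*$ given by the table (the entry in row $a$, column $b$ is $a*b$): $$\begin{array}{c|cccccccc} * & z_{1,0} & z_{2,0} & z_{0,1} & z_{0,2} & z_{1,1} & z_{2,2} & z_{1,2} & z_{2,1}\\ \hline z_{1,0} & z_{2,0} & 0 & -z_{1,1} & 0 & -z_{2,1} & 0 & 0 & -z_{0,1}\\ z_{2,0} & 0 & z_{1,0} & 0 & -z_{2,2} & 0 & -z_{1,2} & -z_{0,2} & 0\\ z_{0,1} & 0 & -z_{2,1} & z_{0,2} & 0 & 0 & -z_{2,0} & 0 & -z_{2,2}\\ z_{0,2} & -z_{1,2} & 0 & 0 & z_{0,1} & -z_{1,0} & 0 & -z_{1,1} & 0\\ z_{1,1} & 0 & -z_{0,1} & -z_{1,2} & 0 & z_{2,2} & 0 & -z_{2,0} & 0\\ z_{2,2} & -z_{0,2} & 0 & 0 & -z_{2,1} & 0 & z_{1,1} & 0 & -z_{1,0}\\ z_{1,2} & -z_{2,2} & 0 & -z_{1,0} &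 0 & 0 & -z_{0,1} & z_{2,1} & 0\\ z_{2,1} & 0 & -z_{1,1} & 0 & -z_{2,0} & -z_{0,2} & 0 & 0 & z_{1,2}\end{array}$$ A two-sided zero divisor is a nonzero $a$ such that $a*b=0$ and $c*a=0$ for some nonzero $b,c$. For $x\neq0$ write $[x]=\mathbb{F}x$. The orthogonality graph $\Gamma_O(\mathcal{O})$ is the undirected graph whose vertices are the lines $[a]$ with $a$ a two-sided zero divisor, two distinct vertices $[a],[b]$ being adjacent if and only if $a*b=b*a=0$. *)

theory Defs
  imports "HOL-Analysis.Cartesian_Space"
    "Graph_Theory.Pair_Digraph" "Graph_Theory.Shortest_Path"
begin

section \<open>The split Okubo algebra\<close>

datatype okubo_basis = Z10 | Z20 | Z01 | Z02 | Z11 | Z22 | Z12 | Z21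

lemma UNIV_okubo_basis: "UNIV = {Z10, Z20, Z01, Z02, Z11, Z22, Z12, Z21}"
  using okubo_basis.exhaust by auto

instance okubo_basis :: finite
  by standard (simp add: UNIV_okubo_basis)

lemma card_okubo_basis: "CARD(okubo_basis) = 8"
  by (simp add: UNIV_okubo_basis)

definition z :: "okubo_basis \<Rightarrow> 'a::field ^ okubo_basis" where
  "z i = axis i 1"

text \<open>
  The multiplication table.  The case combinator takes the eight entries of a row in the order
  of the constructors, i.e. columns Z10, Z20, Z01, Z02, Z11, Z22, Z12, Z21.
\<close>

primrec okubo_table :: "okubo_basis \<Rightarrow> okubo_basis \<Rightarrow> 'a::field ^ okubo_basis" where
  "okubo_table Z10 =
    case_okubo_basis (z Z20) 0 (- z Z11) 0 (- z Z21) 0 0 (- z Z01)"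
| "okubo_table Z20 =
    case_okubo_basis 0 (z Z10) 0 (- z Z22) 0 (- z Z12) (- z Z02) 0"
| "okubo_table Z01 =
    case_okubo_basis 0 (- z Z21) (z Z02) 0 0 (- z Z20) 0 (- z Z22)"
| "okubo_table Z02 =
    case_okubo_basis (- z Z12) 0 0 (z Z01) (- z Z10) 0 (- z Z11) 0"
| "okubo_table Z11 =
    case_okubo_basis 0 (- z Z01) (- z Z12) 0 (z Z22) 0 (- z Z20) 0"
| "okubo_table Z22 =
    case_okubo_basis (- z Z02) 0 0 (- z Z21) 0 (z Z11) 0 (- z Z10)"
| "okubo_table Z12 =
    case_okubo_basis (- z Z22) 0 (- z Z10) 0 0 (- z Z01) (z Z21) 0"
| "okubo_table Z21 =
    case_okubo_basis 0 (- z Z11) 0 (- z Z20) (- z Z02) 0 0 (z Z12)"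

definition okubo_mult ::
    "'a::field ^ okubo_basis \<Rightarrow> 'a ^ okubo_basis \<Rightarrow> 'a ^ okubo_basis" where
  "okubo_mult x y = (\<Sum>i\<in>UNIV. \<Sum>j\<in>UNIV. (x $ i * y $ j) *s okubo_table i j)"

lemma okubo_mult_basis: "okubo_mult (z i) (z j) = okubo_table i j"
proof -
  have "okubo_mult (z i) (z j) =
      (\<Sum>k\<in>UNIV. \<Sum>l\<in>UNIV. if k = i then (if l = j then okubo_table k l else 0) else 0)"
    unfolding okubo_mult_def by (intro sum.cong refl) (auto simp: z_def axis_def)
  also have "\<dots> = (\<Sum>k\<in>UNIV. if k = i then okubo_table k j else 0)"
    by (intro sum.cong refl) auto
  finally show ?thesis by simp
qed

section \<open>The orthogonality graph of an algebra\<close>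

text \<open>
  An algebra structure on a coordinate space is given by its multiplication \<open>m\<close>.  Undirected
  graphs are represented, as usual in the graph library, by symmetric loop-free sets of ordered
  pairs; the vertex set is infinite if the field is.
\<close>

definition two_sided_zero_divisor ::
    "('a::field ^ 'n \<Rightarrow> 'a ^ 'n \<Rightarrow> 'a ^ 'n) \<Rightarrow> 'a ^ 'n \<Rightarrow> bool" where
  "two_sided_zero_divisor m a \<longleftrightarrow>
     a \<noteq> 0 \<and> (\<exists>b. b \<noteq> 0 \<and> m a b = 0) \<and> (\<exists>c. c \<noteq> 0 \<and> m c a = 0)"

definition line :: "'a::field ^ 'n \<Rightarrow> ('a ^ 'n) set" where
  "line x = range (\<lambda>c. c *s x)"

definition orthogonality_graph ::
    "('a::field ^ 'n \<Rightarrow> 'a ^ 'n \<Rightarrow> 'a ^ 'n) \<Rightarrow> ('a ^ 'n) set pair_pre_digraph" where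
  "orthogonality_graph m =
    \<lparr> pverts = {line a | a. two_sided_zero_divisor m a},
      parcs = {(line a, line b) | a b.
        two_sided_zero_divisor m a \<and> two_sided_zero_divisor m b \<and>
        line a \<noteq> line b \<and> m a b = 0 \<and> m b a = 0} \<rparr>"

lemma pair_bidirected_orthogonality_graph:
  "pair_bidirected_digraph (orthogonality_graph m)"
proof
  show "symmetric (orthogonality_graph m)"
    unfolding symmetric_def by (auto simp: orthogonality_graph_def intro!: symI)
qed (auto simp: orthogonality_graph_def)

lemma wf_orthogonality_graph: "wf_digraph (with_proj (orthogonality_graph m))"
  by standard (auto simp: orthogonality_graph_def)

section \<open>Distance and paths of given length\<close>

text \<open>Shortest-path distance with all arc weights one; it is infinite if \<open>v\<close> is not reachable
  from \<open>u\<close>.\<close>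

definition graph_distance :: "'v pair_pre_digraph \<Rightarrow> 'v \<Rightarrow> 'v \<Rightarrow> ereal" where
  "graph_distance G u v = wf_digraph.\<mu> (with_proj G) (\<lambda>_. 1) u v"

text \<open>A path is given by its list of consecutive arcs and has pairwise distinct vertices.\<close>

definition path_of_length ::
    "'v pair_pre_digraph \<Rightarrow> 'v \<Rightarrow> 'v \<Rightarrow> nat \<Rightarrow> ('v \<times> 'v) list \<Rightarrow> bool" where
  "path_of_length G u v k p \<longleftrightarrow> pre_digraph.apath (with_proj G) u p v \<and> length p = k"

end

theory Submission
  imports Defs
begin

text \<open>
  The norm \<open>n\<close> satisfies \<open>(x * y) * x = n(x) y = x * (y * x)\<close>.  Hence zero divisors are
  isotropic, and if \<open>x\<close> is isotropic with \<open>x * x \<noteq> 0\<close>, then \<open>[x * x]\<close> is the only possible neighbour of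
  \<open>[x]\<close>.  The vertices with \<open>(x * x) * (x * x) \<noteq> 0\<close> therefore lie in components \<open>{[x], [x * x]}\<close>.

  In characteristic 3 the solutions of \<open>x * x = 0\<close> form a cone over a conic whose vertex is a plane \<open>L\<close>
  of mutually orthogonal elements.  Each solution outside \<open>L\<close> is orthogonal to exactly one line
  \<open>[l]\<close> of \<open>L\<close>, and to another solution outside \<open>L\<close> only within the span of itself and \<open>l\<close>.  So
  the remaining component is a block graph: the clique of lines of \<open>L\<close>, with cliques attached
  at its vertices, and the pendant vertices with \<open>x * x \<noteq> 0\<close> attached to those.  Block graphs have unique
  shortest paths.
\<close>

section \<open>Graphs with unique shortest paths\<close>

text \<open>
  The function \<open>d\<close> is the distance to \<open>v\<close>; from every other vertex exactly one arc decreases it,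
  so the descent to \<open>v\<close> is forced.
\<close>

definition geodetic_on :: "('v \<times> 'v) set \<Rightarrow> 'v set \<Rightarrow> bool" where
  "geodetic_on E V \<longleftrightarrow> (\<forall>v\<in>V. \<exists>d :: 'v \<Rightarrow> nat. d v = 0 \<and>
     (\<forall>u\<in>V. \<forall>w\<in>V. (u, w) \<in> E \<longrightarrow> d u \<le> Suc (d w)) \<and>
     (\<forall>u\<in>V. u \<noteq> v \<longrightarrow> (\<exists>!w. w \<in> V \<and> (u, w) \<in> E \<and> d u = Suc (d w))))"

lemma geodetic_on_clique:
  assumes "\<And>u w. u \<in> V \<Longrightarrow> w \<in> V \<Longrightarrow> u \<noteq> w \<Longrightarrow> (u, w) \<in> E"
  shows "geodetic_on E V"
  unfolding geodetic_on_def
proof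
  fix v assume v: "v \<in> V"
  show "\<exists>d :: _ \<Rightarrow> nat. d v = 0 \<and>
     (\<forall>u\<in>V. \<forall>w\<in>V. (u, w) \<in> E \<longrightarrow> d u \<le> Suc (d w)) \<and>
     (\<forall>u\<in>V. u \<noteq> v \<longrightarrow> (\<exists>!w. w \<in> V \<and> (u, w) \<in> E \<and> d u = Suc (d w)))"
    by (rule exI[of _ "\<lambda>u. if u = v then 0 else 1"]) (use v assms in auto)
qed

text \<open>
  The new vertices of \<open>N\<close> form cliques, each of which is glued to a single vertex of \<open>V\<close>.
\<close>

lemma geodetic_on_attach:
  assumes V: "geodetic_on E V" and disj: "V \<inter> N = {}" and sym: "sym E"
    and parent: "\<And>x. x \<in> N \<Longrightarrow> \<exists>!p. p \<in> V \<and> (x, p) \<in> E"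
    and common: "\<And>x y. x \<in> N \<Longrightarrow> y \<in> N \<Longrightarrow> (x, y) \<in> E \<Longrightarrow>
      \<exists>p\<in>V. (x, p) \<in> E \<and> (y, p) \<in> E"
    and trans: "\<And>x y w. x \<in> N \<Longrightarrow> y \<in> N \<Longrightarrow> w \<in> N \<Longrightarrow> (x, y) \<in> E \<Longrightarrow> (y, w) \<in> E \<Longrightarrow>
      x \<noteq> w \<Longrightarrow> (x, w) \<in> E"
  shows "geodetic_on E (V \<union> N)"
  unfolding geodetic_on_def
proof
  define par where "par x = (THE p. p \<in> V \<and> (x, p) \<in> E)" for x
  have par: "par x \<in> V" "(x, par x) \<in> E" if "x \<in> N" for x
    using theI'[OF parent[OF that]] by (auto simp: par_def)
  have par_eq: "p = par x" if "x \<in> N" "p \<in> V" "(x, p) \<in> E \<or> (p, x) \<in> E" for x p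
    using parent[OF that(1)] par[OF that(1)] that(2,3) symD[OF sym] by blast
  have par_sib: "par x = par y" if "x \<in> N" "y \<in> N" "(x, y) \<in> E" for x y
    using common[OF that] par_eq that by metis
  fix v assume v: "v \<in> V \<union> N"
  show "\<exists>d :: _ \<Rightarrow> nat. d v = 0 \<and>
     (\<forall>u\<in>V \<union> N. \<forall>w\<in>V \<union> N. (u, w) \<in> E \<longrightarrow> d u \<le> Suc (d w)) \<and>
     (\<forall>u\<in>V \<union> N. u \<noteq> v \<longrightarrow> (\<exists>!w. w \<in> V \<union> N \<and> (u, w) \<in> E \<and> d u = Suc (d w)))"
  proof (cases "v \<in> V")
    case True
    then obtain d :: "_ \<Rightarrow> nat" where d: "d v = 0"
        "\<And>u w. u \<in> V \<Longrightarrow> w \<in> V \<Longrightarrow> (u, w) \<in> E \<Longrightarrow> d u \<le> Suc (d w)"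
        "\<And>u. u \<in> V \<Longrightarrow> u \<noteq> v \<Longrightarrow> \<exists>!w. w \<in> V \<and> (u, w) \<in> E \<and> d u = Suc (d w)"
      using V unfolding geodetic_on_def by metis
    \<comment> \<open>From \<open>N\<close> the only way into \<open>V\<close> is the arc to the
      parent.\<close>
    define D where "D x = (if x \<in> V then d x else Suc (d (par x)))" for x
    have DV: "D x = d x" if "x \<in> V" for x using that by (simp add: D_def)
    have DN: "D x = Suc (d (par x))" if "x \<in> N" for x using that disj by (auto simp: D_def)
    show ?thesis
    proof (intro exI[of _ D] conjI ballI impI)
      show "D v = 0" using d(1) True DV by simp
    next
      fix u w assume uw: "u \<in> V \<union> N" "w \<in> V \<union> N" "(u, w) \<in> E"
      consider "u \<in> V" "w \<in> V" | "u \<in> V" "w \<in> N" | "u \<in> N" "w \<in> V" | "u \<in> N" "w \<in> N"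
        using uw by blast
      then show "D u \<le> Suc (D w)"
      proof cases
        case 1
        then show ?thesis using d(2) uw by (simp add: DV)
      next
        case 2
        then have "u = par w" using par_eq uw by blast
        then show ?thesis using 2 by (simp add: DV DN)
      next
        case 3
        then have "w = par u" using par_eq uw by blast
        then show ?thesis using 3 by (simp add: DV DN)
      next
        case 4
        then show ?thesis using par_sib uw by (simp add: DN)
      qed
    next
      fix u assume u: "u \<in> V \<union> N" "u \<noteq> v"
      show "\<exists>!w. w \<in> V \<union> N \<and> (u, w) \<in> E \<and> D u = Suc (D w)"
      proof (cases "u \<in> V")
        case True
        \<comment> \<open>An arc from \<open>V\<close> into \<open>N\<close> leads away from
          \<open>v\<close>, so it never descends.\<close>
        have "w \<in> V" if "w \<in> V \<union> N" "(u, w) \<in> E" "D u = Suc (D w)" for w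
        proof (rule ccontr)
          assume "w \<notin> V"
          then have "w \<in> N" using that by simp
          moreover from this have "u = par w" using par_eq that True by blast
          ultimately show False using that True by (simp add: DV DN)
        qed
        then show ?thesis using d(3)[OF True u(2)] True by (metis DV Un_iff)
      next
        case False
        then have uN: "u \<in> N" using u by simp
        show ?thesis
        proof (rule ex1I[of _ "par u"])
          show "par u \<in> V \<union> N \<and> (u, par u) \<in> E \<and> D u = Suc (D (par u))"
            using par[OF uN] by (simp add: DV DN uN)
        next
          fix w assume "w \<in> V \<union> N \<and> (u, w) \<in> E \<and> D u = Suc (D w)"
          then consider "w = par u" | "w \<in> N" "par u = par w" "D u = Suc (D w)"
            using par_eq[OF uN] par_sib[OF uN] by blast
          then show "w = par u" by cases (simp_all add: DN uN)
        qed
      qed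
    qed
  next
    case False
    then have vN: "v \<in> N" using v by simp
    obtain d :: "_ \<Rightarrow> nat" where d: "d (par v) = 0"
        "\<And>u w. u \<in> V \<Longrightarrow> w \<in> V \<Longrightarrow> (u, w) \<in> E \<Longrightarrow> d u \<le> Suc (d w)"
        "\<And>u. u \<in> V \<Longrightarrow> u \<noteq> par v \<Longrightarrow> \<exists>!w. w \<in> V \<and> (u, w) \<in> E \<and> d u = Suc (d w)"
      using V par(1)[OF vN] unfolding geodetic_on_def by metis
    \<comment> \<open>Clique mates of \<open>v\<close> are one arc away. Everything else reaches
      \<open>v\<close> through \<open>par v\<close>: this adds 1 to the old distance on
      \<open>V\<close>, and 2 on \<open>N\<close>, where the step to the parent counts as
      well.\<close>
    define D where "D x = (if x \<in> V then Suc (d x) else if x = v then 0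
        else if (x, v) \<in> E then 1 else Suc (Suc (d (par x))))" for x
    have DV: "D x = Suc (d x)" if "x \<in> V" for x using that by (simp add: D_def)
    have Dv: "D v = 0" using False by (simp add: D_def)
    have D1: "D x = 1" if "x \<in> N" "x \<noteq> v" "(x, v) \<in> E" for x
      using that disj by (auto simp: D_def)
    have D2: "D x = Suc (Suc (d (par x)))" if "x \<in> N" "x \<noteq> v" "(x, v) \<notin> E" for x
      using that disj by (auto simp: D_def)
    have DN_le: "D x \<le> Suc (Suc (d (par x)))" if "x \<in> N" for x
      using that disj by (auto simp: D_def)
    have D0: "D x = 0 \<longleftrightarrow> x = v" for x using False by (auto simp: D_def)
    show ?thesis
    proof (intro exI[of _ D] conjI ballI impI)
      show "D v = 0" by (rule Dv)
    next
      fix u w assume uw: "u \<in> V \<union> N" "w \<in> V \<union> N" "(u, w) \<in> E"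
      consider "u \<in> V" "w \<in> V" | "u \<in> V" "w \<in> N" | "u \<in> N" "w \<in> V" | "u \<in> N" "w \<in> N"
        using uw by blast
      then show "D u \<le> Suc (D w)"
      proof cases
        case 1
        then show ?thesis using d(2) uw by (simp add: DV)
      next
        case 2
        then have "u = par w" using par_eq uw by blast
        moreover have "par w = par v" if "(w, v) \<in> E" using par_sib[OF 2(2) vN that] .
        ultimately show ?thesis
          using 2 d(1) by (cases "w = v"; cases "(w, v) \<in> E") (auto simp: DV Dv D1 D2)
      next
        case 3
        then show ?thesis using par_eq[of u w] uw DN_le[of u] by (auto simp: DV)
      next
        case 4
        consider "w = v" | "w \<noteq> v" "(w, v) \<in> E" | "w \<noteq> v" "(w, v) \<notin> E" by blast
        then show ?thesis
        proof cases
          case 1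
          then show ?thesis using 4 uw D1[of u] Dv by (cases "u = v") auto
        next
          case 2
          then have "u = v \<or> (u, v) \<in> E" using trans[OF 4 vN] uw by blast
          then show ?thesis using 4 D1[of u] Dv by (cases "u = v") auto
        next
          case 3
          then show ?thesis using DN_le[of u] D2[of w] par_sib[OF 4 uw(3)] 4 by simp
        qed
      qed
    next
      fix u assume u: "u \<in> V \<union> N" "u \<noteq> v"
      consider "u = par v" | "u \<in> V" "u \<noteq> par v" | "u \<in> N" "(u, v) \<in> E" | "u \<in> N" "(u, v) \<notin> E"
        using u by blast
      then show "\<exists>!w. w \<in> V \<union> N \<and> (u, w) \<in> E \<and> D u = Suc (D w)"
      proof cases
        case 1
        then have "D u = 1" using par(1)[OF vN] d(1) by (simp add: DV)
        then show ?thesis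
          using 1 vN par(2)[OF vN] symD[OF sym] by (intro ex1I[of _ v]) (auto simp: Dv D0)
      next
        case 2
        \<comment> \<open>A neighbour of \<open>u\<close> in \<open>N\<close> has parent
          \<open>u\<close>, which is not \<open>par v\<close>. It is therefore outside the clique of
          \<open>v\<close> and farther from \<open>v\<close> than \<open>u\<close>.\<close>
        have inV: "w \<in> V" if w: "w \<in> V \<union> N" "(u, w) \<in> E" "D u = Suc (D w)" for w
        proof (rule ccontr)
          assume "w \<notin> V"
          then have wN: "w \<in> N" using w by simp
          then have pw: "u = par w" using par_eq w 2 by blast
          then have "w \<noteq> v" "(w, v) \<notin> E" using 2 par_sib[OF wN vN] by auto
          then show False using D2[OF wN] w pw 2 by (simp add: DV)
        qed
        then have "w \<in> V \<union> N \<and> (u, w) \<in> E \<and> D u = Suc (D w) \<longleftrightarrow>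
            w \<in> V \<and> (u, w) \<in> E \<and> d u = Suc (d w)" for w
          using inV[of w] DV[of w] DV[of u] 2 by (cases "w \<in> V") auto
        then show ?thesis using d(3)[OF 2] by simp
      next
        case 3
        then show ?thesis using vN u D1[of u] by (intro ex1I[of _ v]) (auto simp: Dv D0)
      next
        case 4
        show ?thesis
        proof (rule ex1I[of _ "par u"])
          show "par u \<in> V \<union> N \<and> (u, par u) \<in> E \<and> D u = Suc (D (par u))"
            using par[OF 4(1)] D2[OF 4(1) u(2) 4(2)] by (simp add: DV)
        next
          fix w assume w: "w \<in> V \<union> N \<and> (u, w) \<in> E \<and> D u = Suc (D w)"
          show "w = par u"
          proof (cases "w \<in> V")
            case True
            then show ?thesis using par_eq[OF 4(1)] w by blast
          next
            case False
            then have wN: "w \<in> N" using w by simp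
            have "w \<noteq> v" using w 4 by auto
            \<comment> \<open>By transitivity an arc from \<open>w\<close> to \<open>v\<close> would
              make \<open>u\<close> adjacent to \<open>v\<close>. So \<open>w\<close> has the same
              value of \<open>D\<close> as \<open>u\<close>, and the step does not descend.\<close>
            moreover have "(w, v) \<notin> E" using trans[OF 4(1) wN vN] w 4 u by blast
            ultimately show ?thesis
              using D2[OF wN] D2[OF 4(1) u(2) 4(2)] par_sib[OF 4(1) wN] w by simp
          qed
        qed
      qed
    qed
  qed
qed

section \<open>From descent functions to unique shortest paths\<close>

text \<open>An arc lowers \<open>d\<close> by at most one, so a walk from \<open>u\<close> to
  \<open>v\<close> has at least \<open>d u\<close> arcs. Equality forces every arc to be the unique
  descending one. Closedness of \<open>V\<close> keeps all walks inside the set where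
  \<open>d\<close> is controlled.\<close>

lemma ex1_path_of_length:
  assumes wf: "wf_digraph (with_proj G)"
    and geo: "geodetic_on (parcs G) V" and V: "V \<subseteq> pverts G" "u \<in> V"
    and closed: "\<And>x y. x \<in> V \<Longrightarrow> (x, y) \<in> parcs G \<Longrightarrow> y \<in> V"
    and dist: "graph_distance G u v = ereal (real k)"
  shows "\<exists>!p. path_of_length G u v k p"
proof -
  interpret wf_digraph "with_proj G" by (rule wf)
  have walk_closed: "y \<in> V" if "awalk x p y" "x \<in> V" for x p y
    using that by (induction p arbitrary: x) (auto simp: awalk_simps dest: closed)
  \<comment> \<open>Finite distance means reachability, which places \<open>v\<close> in
    \<open>V\<close> and so provides \<open>d\<close>.\<close>
  have "\<exists>p. awalk u p v"
  proof (rule ccontr)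
    assume "\<nexists>p. awalk u p v"
    then have "\<mu> (\<lambda>_. 1) u v = \<infinity>" by (intro shortest_path_inf) (simp add: reachable_awalk)
    then show False using dist by (simp add: graph_distance_def)
  qed
  then have "v \<in> V" using walk_closed V by blast
  then obtain d :: "_ \<Rightarrow> nat" where dv: "d v = 0"
      and d_step: "\<And>x y. x \<in> V \<Longrightarrow> y \<in> V \<Longrightarrow> (x, y) \<in> parcs G \<Longrightarrow> d x \<le> Suc (d y)"
      and d_desc: "\<And>x. x \<in> V \<Longrightarrow> x \<noteq> v \<Longrightarrow>
        \<exists>!y. y \<in> V \<and> (x, y) \<in> parcs G \<and> d x = Suc (d y)"
    using geo unfolding geodetic_on_def by metis
  have cost: "awalk_cost (\<lambda>_. 1) p = real (length p)" for p
    by (induction p) (auto simp: awalk_cost_def)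
  have lower: "d x \<le> length p" if "awalk x p v" "x \<in> V" for x p
    using that
  proof (induction p arbitrary: x)
    case (Cons e p)
    then have "awalk (snd e) p v" "e \<in> parcs G" "x = fst e" by (auto simp: awalk_simps)
    then show ?case using Cons.IH[of "snd e"] Cons.prems d_step[of x "snd e"] closed[of x "snd e"]
      by (cases e) auto
  qed (auto simp: awalk_simps dv)
  \<comment> \<open>The bound on \<open>d\<close> along the path shows that a new first vertex,
    whose \<open>d\<close> is larger by one, does not occur on it already.\<close>
  have path: "\<exists>p. apath x p v \<and> length p = d x \<and> (\<forall>y\<in>set (awalk_verts x p). d y \<le> d x)"
    if "x \<in> V" "d x = n" for x n
    using that
  proof (induction n arbitrary: x)
    case 0
    then have "x = v" using d_desc[of x] by auto
    then show ?case using V 0 by (intro exI[of _ "[]"]) (auto simp: apath_def awalk_simps)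
  next
    case (Suc n)
    then have "x \<noteq> v" using dv by auto
    then obtain y where y: "y \<in> V" "(x, y) \<in> parcs G" "d x = Suc (d y)"
      using d_desc[OF Suc.prems(1)] by blast
    then obtain p where "apath y p v" "length p = d y" "\<forall>w\<in>set (awalk_verts y p). d w \<le> d y"
      using Suc by auto
    then show ?case
      using y Suc.prems V by (intro exI[of _ "(x, y) # p"]) (auto simp: apath_def awalk_simps)
  qed
  have unique: "p = q" if "awalk x p v" "awalk x q v" "x \<in> V" "length p = d x" "length q = d x"
    for x p q
    using that
  proof (induction p arbitrary: x q)
    case (Cons e p)
    then obtain e' q' where q: "q = e' # q'" by (cases q) auto
    have e: "e = (x, snd e)" "e' = (x, snd e')" "e \<in> parcs G" "e' \<in> parcs G"
        "awalk (snd e) p v" "awalk (snd e') q' v"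
      using Cons.prems q by (auto simp: awalk_simps prod_eq_iff)
    have inV: "snd e \<in> V" "snd e' \<in> V" using e closed Cons.prems by metis+
    \<comment> \<open>\<open>lower\<close> applied to the remaining walk gives one inequality,
      \<open>d_step\<close> the other.\<close>
    have "d x = Suc (d (snd e))" "d x = Suc (d (snd e'))"
      using lower[OF e(5) inV(1)] lower[OF e(6) inV(2)] d_step[of x "snd e"] d_step[of x "snd e'"]
        e inV Cons.prems q by auto
    moreover have "x \<noteq> v" using Cons.prems dv by auto
    ultimately have "snd e = snd e'" using d_desc[of x] e inV Cons.prems by metis
    then show ?case
      using Cons.IH[OF e(5)] e q inV Cons.prems \<open>d x = Suc (d (snd e))\<close>
      by (auto simp: prod_eq_iff)
  qed simp
  obtain p where p: "apath u p v" "length p = d u" using path[OF V(2)] by blast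
  have "\<mu> (\<lambda>_. 1) u v = ereal (real (d u))"
  proof (rule antisym)
    show "\<mu> (\<lambda>_. 1) u v \<le> ereal (real (d u))"
      using min_cost_le_walk_cost[of u p v "\<lambda>_. 1"] p by (simp add: cost apath_def)
    show "ereal (real (d u)) \<le> \<mu> (\<lambda>_. 1) u v"
      unfolding \<mu>_def using lower V by (auto intro!: INF_greatest simp: cost)
  qed
  then have "k = d u" using dist by (simp add: graph_distance_def)
  then show ?thesis
    unfolding path_of_length_def using p unique V(2)
    by (intro ex1I[of _ p]) (auto simp: apath_def)
qed

section \<open>The norm\<close>

lemma forall_okubo_basis:
  "(\<forall>i. P i) \<longleftrightarrow> P Z10 \<and> P Z20 \<and> P Z01 \<and> P Z02 \<and> P Z11 \<and> P Z22 \<and> P Z12 \<and> P Z21"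
  by (metis okubo_basis.exhaust)

lemma okubo_mult_nth:
  fixes x y :: "'a::field ^ okubo_basis"
  shows
    "okubo_mult x y $ Z10 = x$Z20 * y$Z20 - x$Z02 * y$Z11 - x$Z22 * y$Z21 - x$Z12 * y$Z01"
    "okubo_mult x y $ Z20 = x$Z10 * y$Z10 - x$Z01 * y$Z22 - x$Z11 * y$Z12 - x$Z21 * y$Z02"
    "okubo_mult x y $ Z01 = x$Z02 * y$Z02 - x$Z10 * y$Z21 - x$Z11 * y$Z20 - x$Z12 * y$Z22"
    "okubo_mult x y $ Z02 = x$Z01 * y$Z01 - x$Z20 * y$Z12 - x$Z22 * y$Z10 - x$Z21 * y$Z11"
    "okubo_mult x y $ Z11 = x$Z22 * y$Z22 - x$Z10 * y$Z01 - x$Z02 * y$Z12 - x$Z21 * y$Z20"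
    "okubo_mult x y $ Z22 = x$Z11 * y$Z11 - x$Z20 * y$Z02 - x$Z01 * y$Z21 - x$Z12 * y$Z10"
    "okubo_mult x y $ Z12 = x$Z21 * y$Z21 - x$Z20 * y$Z22 - x$Z02 * y$Z10 - x$Z11 * y$Z01"
    "okubo_mult x y $ Z21 = x$Z12 * y$Z12 - x$Z10 * y$Z11 - x$Z01 * y$Z20 - x$Z22 * y$Z02"
  unfolding okubo_mult_def UNIV_okubo_basis
  by (simp_all add: z_def axis_def)

text \<open>A hyperbolic form: each index of (Z/3)^2 is paired with its negative.\<close>

definition okubo_norm :: "'a::field ^ okubo_basis \<Rightarrow> 'a" where
  "okubo_norm x = x$Z10 * x$Z20 + x$Z01 * x$Z02 + x$Z11 * x$Z22 + x$Z12 * x$Z21"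

definition okubo_polar :: "'a::field ^ okubo_basis \<Rightarrow> 'a ^ okubo_basis \<Rightarrow> 'a" where
  "okubo_polar x y = okubo_norm (x + y) - okubo_norm x - okubo_norm y"

lemma okubo_polar_eq:
  "okubo_polar x y = x$Z10 * y$Z20 + x$Z20 * y$Z10 + x$Z01 * y$Z02 + x$Z02 * y$Z01
     + x$Z11 * y$Z22 + x$Z22 * y$Z11 + x$Z12 * y$Z21 + x$Z21 * y$Z12"
  by (simp add: okubo_polar_def okubo_norm_def algebra_simps)

lemma okubo_mult_lin:
  "okubo_mult (x + y) w = okubo_mult x w + okubo_mult y w"
  "okubo_mult x (y + w) = okubo_mult x y + okubo_mult x w"
  "okubo_mult (x - y) w = okubo_mult x w - okubo_mult y w"
  "okubo_mult x (y - w) = okubo_mult x y - okubo_mult x w"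
  "okubo_mult (c *s x) w = c *s okubo_mult x w"
  "okubo_mult x (c *s w) = c *s okubo_mult x w"
  by (simp_all add: vec_eq_iff forall_okubo_basis okubo_mult_nth algebra_simps)

lemma okubo_mult_zero [simp]: "okubo_mult 0 x = 0" "okubo_mult x 0 = 0"
  by (simp_all add: vec_eq_iff forall_okubo_basis okubo_mult_nth)

text \<open>This is the linearisation of \<open>x * (y * x) = n(x) y\<close> in
  \<open>x\<close>.\<close>

lemma okubo_alternative_right:
  "okubo_mult b (okubo_mult c d) + okubo_mult d (okubo_mult c b) = okubo_polar b d *s c"
  by (simp add: vec_eq_iff forall_okubo_basis okubo_mult_nth okubo_polar_eq algebra_simps)

lemma okubo_alternative:
  "okubo_mult x (okubo_mult y x) = okubo_norm x *s y"
  "okubo_mult (okubo_mult x y) x = okubo_norm x *s y"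
  by (simp_all add: vec_eq_iff forall_okubo_basis okubo_mult_nth okubo_norm_def algebra_simps)

lemma okubo_polar_assoc:
  "okubo_polar (okubo_mult x y) w = okubo_polar x (okubo_mult y w)"
  by (simp add: okubo_mult_nth okubo_polar_eq algebra_simps)

section \<open>Orthogonality and squares\<close>

definition okubo_orth :: "'a::field ^ okubo_basis \<Rightarrow> 'a ^ okubo_basis \<Rightarrow> bool" where
  "okubo_orth x y \<longleftrightarrow> okubo_mult x y = 0 \<and> okubo_mult y x = 0"

lemma okubo_orth_commute: "okubo_orth x y \<longleftrightarrow> okubo_orth y x"
  by (auto simp: okubo_orth_def)

lemma okubo_orth_scale:
  "c \<noteq> 0 \<Longrightarrow> okubo_orth (c *s x) y \<longleftrightarrow> okubo_orth x y"
  "c \<noteq> 0 \<Longrightarrow> okubo_orth x (c *s y) \<longleftrightarrow> okubo_orth x y"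
  by (simp_all add: okubo_orth_def okubo_mult_lin)

lemma okubo_polar_commute: "okubo_polar x y = okubo_polar y x"
  by (simp add: okubo_polar_def add.commute)

text \<open>Pairing with the basis vector of the opposite index reads off a coordinate.\<close>

lemma okubo_polar_nondegenerate:
  assumes "x \<noteq> 0"
  obtains y where "okubo_polar x y \<noteq> 0"
proof -
  have "x $ Z10 = okubo_polar x (z Z20)" "x $ Z20 = okubo_polar x (z Z10)"
    "x $ Z01 = okubo_polar x (z Z02)" "x $ Z02 = okubo_polar x (z Z01)"
    "x $ Z11 = okubo_polar x (z Z22)" "x $ Z22 = okubo_polar x (z Z11)"
    "x $ Z12 = okubo_polar x (z Z21)" "x $ Z21 = okubo_polar x (z Z12)"
    by (simp_all add: okubo_polar_eq z_def axis_def)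
  then show thesis
    using assms that by (auto simp: vec_eq_iff forall_okubo_basis)
qed

lemma zero_divisor_norm:
  assumes "two_sided_zero_divisor okubo_mult x"
  shows "okubo_norm x = 0"
proof -
  obtain y where "y \<noteq> 0" "okubo_mult x y = 0"
    using assms by (auto simp: two_sided_zero_divisor_def)
  then show ?thesis using okubo_alternative(2)[of x y] by simp
qed

lemma okubo_orth_imp_zero_divisor:
  "okubo_orth x y \<Longrightarrow> x \<noteq> 0 \<Longrightarrow> y \<noteq> 0 \<Longrightarrow> two_sided_zero_divisor okubo_mult x"
  by (auto simp: okubo_orth_def two_sided_zero_divisor_def)

lemma okubo_orth_square:
  "okubo_norm x = 0 \<Longrightarrow> okubo_orth x (okubo_mult x x)"
  by (simp add: okubo_orth_def okubo_alternative)

text \<open>The product \<open>x * (y * (x * w))\<close> is evaluated in two ways by the linearised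
  identity. One gives a multiple of \<open>y\<close>, the other a multiple of \<open>x * x\<close>.
  Associativity of the polar form turns the first coefficient into the pairing of
  \<open>x * x\<close> with \<open>w\<close>, which is nonzero for a suitable
  \<open>w\<close>.\<close>

lemma okubo_orth_square_unique:
  assumes orth: "okubo_orth x y" and sq: "okubo_mult x x \<noteq> 0"
  obtains c where "y = c *s okubo_mult x x"
proof -
  obtain w where w: "okubo_polar (okubo_mult x x) w \<noteq> 0"
    using okubo_polar_nondegenerate[OF sq] .
  have "okubo_polar (okubo_mult x x) w *s y = okubo_mult x (okubo_mult y (okubo_mult x w))"
    using okubo_alternative_right[of "okubo_mult x w" y x] orth
    by (simp add: okubo_orth_def okubo_polar_assoc okubo_polar_commute[of x])
  also have "okubo_mult y (okubo_mult x w) = okubo_polar y w *s x"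
    using okubo_alternative_right[of y x w] orth by (simp add: okubo_orth_def)
  finally have "okubo_polar (okubo_mult x x) w *s y = okubo_polar y w *s okubo_mult x x"
    by (simp add: okubo_mult_lin)
  then have "y = (okubo_polar y w / okubo_polar (okubo_mult x x) w) *s okubo_mult x x"
    using w by (simp add: vec_eq_iff field_simps)
  then show thesis by (rule that)
qed

text \<open>Squaring twice returns to the line of \<open>x\<close> or gives zero; this separates the
  two kinds of components.\<close>

lemma okubo_square_square:
  assumes "okubo_norm x = 0"
  shows "okubo_mult (okubo_mult x x) (okubo_mult x x) = okubo_polar (okubo_mult x x) x *s x"
  using okubo_alternative_right[of "okubo_mult x x" x x] okubo_orth_square[OF assms]
  by (simp add: okubo_orth_def)

section \<open>Elements of square zero in characteristic 3\<close>

text \<open>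
  Regard the coefficients of a vector as a function of the index \<open>(i, j) \<in> (\<int>/3)\<^sup>2 - {0}\<close>.
  In characteristic 3 the coefficients of \<open>nil_vec p q a b c\<close> are the values of the polynomial
  \<open>p i + q j + a i\<^sup>2 + b i j + c j\<^sup>2\<close>, where the index entry 2 stands for \<open>- 1\<close>.
\<close>

definition nil_vec :: "'a::field \<Rightarrow> 'a \<Rightarrow> 'a \<Rightarrow> 'a \<Rightarrow> 'a \<Rightarrow> 'a ^ okubo_basis" where
  "nil_vec p q a b c = (\<chi> i. case i of
     Z10 \<Rightarrow> p + a | Z20 \<Rightarrow> a - p | Z01 \<Rightarrow> q + c | Z02 \<Rightarrow> c - q
   | Z11 \<Rightarrow> p + q + a + b + c | Z22 \<Rightarrow> a + b + c - p - q
   | Z12 \<Rightarrow> p - q + a - b + c | Z21 \<Rightarrow> q - p + a - b + c)"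

lemma nil_vec_nth [simp]:
  "nil_vec p q a b c $ Z10 = p + a" "nil_vec p q a b c $ Z20 = a - p"
  "nil_vec p q a b c $ Z01 = q + c" "nil_vec p q a b c $ Z02 = c - q"
  "nil_vec p q a b c $ Z11 = p + q + a + b + c" "nil_vec p q a b c $ Z22 = a + b + c - p - q"
  "nil_vec p q a b c $ Z12 = p - q + a - b + c" "nil_vec p q a b c $ Z21 = q - p + a - b + c"
  by (simp_all add: nil_vec_def)

lemma two_eq_minus_one:
  assumes "CHAR('a::field) = 3"
  shows "(2::'a) = - 1"
  using of_nat_CHAR[where 'a='a] assms by (simp add: eq_neg_iff_add_eq_0)

text \<open>Here \<open>1\<close> is the constant function, with all coordinates 1. The quadratic
  coefficients of the product are the 2 by 2 minors of the two quadratic parts, up to sign. The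
  constant is minus the polar form of \<open>b\<^sup>2 - a * c\<close>. Every term contains a
  quadratic coefficient of a factor.\<close>

lemma okubo_mult_nil_vec:
  fixes p q a b c :: "'a::field"
  assumes "CHAR('a) = 3"
  shows "okubo_mult (nil_vec p q a b c) (nil_vec p' q' a' b' c') =
    nil_vec (b * p' - p * b' + a * q' - q * a') (q * b' - b * q' + p * c' - c * p')
      (a * b' - b * a') (c * a' - a * c') (b * c' - c * b') + (b * b' + a * c' + c * a') *s 1"
  by (simp add: vec_eq_iff forall_okubo_basis okubo_mult_nth algebra_simps
      two_eq_minus_one[OF assms])

lemma square_zero_imp_nil_vec:
  fixes x :: "'a::field ^ okubo_basis"
  assumes char: "CHAR('a) = 3" and sq: "okubo_mult x x = 0"
  obtains p q a b c where "x = nil_vec p q a b c" "b\<^sup>2 = a * c"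
proof -
  note two = two_eq_minus_one[OF char]
  \<comment> \<open>\<open>e\<close>, \<open>f\<close>, \<open>h\<close> are the coefficients of \<open>i\<^sup>2 j\<^sup>2\<close>, \<open>i\<^sup>2 j\<close>, \<open>i j\<^sup>2\<close> when the coefficients of
    \<open>x\<close> are interpolated by a polynomial in \<open>i\<close>, \<open>j\<close>.\<close>
  define e where "e = x$Z10 + x$Z20 + x$Z01 + x$Z02 + x$Z11 + x$Z22 + x$Z12 + x$Z21"
  define f where "f = x$Z01 - x$Z02 + x$Z11 - x$Z22 - x$Z12 + x$Z21"
  define h where "h = x$Z10 - x$Z20 + x$Z11 - x$Z22 + x$Z12 - x$Z21"
  define p q a b c where
    "p = x$Z20 - x$Z10" and "q = x$Z02 - x$Z01" and "a = - x$Z10 - x$Z20" and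
    "b = x$Z11 + x$Z22 - x$Z12 - x$Z21" and "c = - x$Z01 - x$Z02"
  define s where "s = okubo_mult x x"
  have s: "s $ i = 0" for i using sq by (simp add: s_def)
  have "okubo_norm x = 0"
  proof (cases "x = 0")
    case False
    then show ?thesis using okubo_alternative(1)[of x x] sq by simp
  qed (simp add: okubo_norm_def)
  moreover have "e\<^sup>2 =
      s$Z10 + s$Z20 + s$Z01 + s$Z02 + s$Z11 + s$Z22 + s$Z12 + s$Z21 - okubo_norm x"
    by (simp add: s_def e_def okubo_mult_nth okubo_norm_def power2_eq_square algebra_simps two)
  ultimately have e: "e = 0" by (simp add: s)
  \<comment> \<open>Eliminating one coordinate turns the facts below into polynomial identities that
    \<open>algebra_simps\<close> can check.\<close>
  then have x21: "x$Z21 = - (x$Z10 + x$Z20 + x$Z01 + x$Z02 + x$Z11 + x$Z22 + x$Z12)"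
    unfolding e_def by (simp add: eq_neg_iff_add_eq_0 algebra_simps)
  have "f * h = s$Z12 + s$Z21 - s$Z11 - s$Z22"
    by (simp add: s_def f_def h_def okubo_mult_nth x21 algebra_simps two)
  moreover have "f\<^sup>2 - h\<^sup>2 = s$Z10 + s$Z20 - s$Z01 - s$Z02"
    by (simp add: s_def f_def h_def okubo_mult_nth x21 power2_eq_square algebra_simps two)
  \<comment> \<open>The product \<open>f * h\<close> vanishes and the squares agree, so both factors
    vanish.\<close>
  ultimately have fh: "f = 0" "h = 0" by (auto simp: s)
  have "b\<^sup>2 - a * c = s$Z10 + s$Z20 + s$Z01 + s$Z02 - p * h - q * f"
    by (simp add: s_def p_def q_def a_def b_def c_def f_def h_def okubo_mult_nth x21
        power2_eq_square algebra_simps two)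
  then have "b\<^sup>2 = a * c" by (simp add: s fh)
  \<comment> \<open>The interpolation error is a combination of \<open>e\<close>, \<open>f\<close>
    and \<open>h\<close>, all of which vanish.\<close>
  moreover have "x $ i - nil_vec p q a b c $ i = e * (if i \<in> {Z11, Z22, Z12, Z21} then 1 else 0)
      + f * (if i \<in> {Z11, Z21} then 1 else if i \<in> {Z22, Z12} then - 1 else 0)
      + h * (if i \<in> {Z11, Z12} then 1 else if i \<in> {Z22, Z21} then - 1 else 0)" for i
    by (cases i) (simp_all add: e_def f_def h_def p_def q_def a_def b_def c_def algebra_simps two)
  then have "x = nil_vec p q a b c" using e fh by (simp add: vec_eq_iff)
  ultimately show thesis using that by blast
qed

section \<open>The plane of linear polynomials and its neighbours\<close>

text \<open>This is the plane \<open>L\<close>, the vertex of the cone.\<close>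

definition nil_core :: "('a::field ^ okubo_basis) set" where
  "nil_core = {nil_vec p q 0 0 0 | p q. True}"

lemma nil_vec_lin:
  "nil_vec p q a b c + nil_vec p' q' a' b' c' =
    nil_vec (p + p') (q + q') (a + a') (b + b') (c + c')"
  "t *s nil_vec p q a b c = nil_vec (t * p) (t * q) (t * a) (t * b) (t * c)"
  by (simp_all add: vec_eq_iff forall_okubo_basis algebra_simps)

lemma nil_vec_eq_0_iff:
  assumes "CHAR('a::field) = 3"
  shows "nil_vec p q a b c + e *s 1 = (0 :: 'a ^ okubo_basis) \<longleftrightarrow>
    p = 0 \<and> q = 0 \<and> a = 0 \<and> b = 0 \<and> c = 0 \<and> e = 0"
proof
  assume "nil_vec p q a b c + e *s 1 = (0 :: 'a ^ okubo_basis)"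
  define x where "x = nil_vec p q a b c + e *s 1"
  have x: "x $ i = 0" for i using \<open>nil_vec p q a b c + e *s 1 = 0\<close> by (simp add: x_def)
  \<comment> \<open>Inverse interpolation: in characteristic 3 the six coefficients are linear in
    the coordinates.\<close>
  have "e = - (x$Z10 + x$Z20 + x$Z01 + x$Z02 + x$Z11 + x$Z22 + x$Z12 + x$Z21)"
    "p = x$Z20 - x$Z10" "q = x$Z02 - x$Z01" "a = - x$Z10 - x$Z20 - e"
    "b = x$Z11 + x$Z22 - x$Z12 - x$Z21" "c = - x$Z01 - x$Z02 - e"
    by (simp_all add: x_def algebra_simps two_eq_minus_one[OF assms])
  then show "p = 0 \<and> q = 0 \<and> a = 0 \<and> b = 0 \<and> c = 0 \<and> e = 0" by (simp add: x)
qed (simp add: vec_eq_iff forall_okubo_basis)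

lemma nil_core_scale: "x \<in> nil_core \<Longrightarrow> t *s x \<in> nil_core"
  by (force simp: nil_core_def nil_vec_lin)

lemma zero_in_nil_core [simp]: "0 \<in> nil_core"
  using nil_core_scale[of "nil_vec 0 0 0 0 0" 0] by (force simp: nil_core_def)

lemma nil_core_orth:
  assumes "CHAR('a::field) = 3" "x \<in> nil_core" "y \<in> (nil_core :: ('a ^ okubo_basis) set)"
  shows "okubo_orth x y"
  using assms(2,3) nil_vec_eq_0_iff[OF assms(1), where e = 0]
  by (auto simp: nil_core_def okubo_orth_def okubo_mult_nil_vec[OF assms(1)])

text \<open>Orthogonality to a linear polynomial is a homogeneous 2 by 2 system with determinant
  \<open>b\<^sup>2 - a * c\<close>. On the conic this is zero, while the matrix is not, so the
  kernel is a line.\<close>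

lemma nil_core_neighbour:
  fixes x :: "'a::field ^ okubo_basis"
  assumes char: "CHAR('a) = 3" and x: "okubo_mult x x = 0" "x \<notin> nil_core"
  obtains l where "l \<in> nil_core" "l \<noteq> 0" "okubo_orth x l"
    "\<And>y. y \<in> nil_core \<Longrightarrow> okubo_orth x y \<Longrightarrow> \<exists>t. y = t *s l"
proof -
  obtain p q a b c where nil: "x = nil_vec p q a b c" "b\<^sup>2 = a * c"
    using square_zero_imp_nil_vec[OF char x(1)] .
  have nonzero: "a \<noteq> 0 \<or> b \<noteq> 0 \<or> c \<noteq> 0" using x(2) nil(1) by (auto simp: nil_core_def)
  have orth_iff: "okubo_orth x (nil_vec s t 0 0 0) \<longleftrightarrow> b * s + a * t = 0 \<and> b * t + c * s = 0"
    for s t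
    using nil_vec_eq_0_iff[OF char, where e = 0]
    by (auto simp: okubo_orth_def nil(1) okubo_mult_nil_vec[OF char]
        eq_neg_iff_add_eq_0 neg_eq_iff_add_eq_0 algebra_simps)
  have nz: "nil_vec s t 0 0 0 = (0 :: 'a ^ okubo_basis) \<longleftrightarrow> s = 0 \<and> t = 0" for s t
    using nil_vec_eq_0_iff[OF char, of s t 0 0 0 0] by simp
  show thesis
  proof (cases "a = 0")
    case True
    then have "b = 0" "c \<noteq> 0" using nil(2) nonzero by auto
    then show thesis using True
      by (intro that[of "nil_vec 0 1 0 0 0"])
        (auto simp: orth_iff nz nil_vec_lin nil_core_def)
  next
    case False
    show thesis
    \<comment> \<open>The pair \<open>(a, - b)\<close> solves the first equation; the second then
      holds by \<open>b\<^sup>2 = a * c\<close>.\<close>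
    proof (rule that[of "nil_vec a (- b) 0 0 0"])
      show "okubo_orth x (nil_vec a (- b) 0 0 0)"
        using nil(2) by (simp add: orth_iff power2_eq_square algebra_simps)
      show "\<exists>t. y = t *s nil_vec a (- b) 0 0 0" if y: "y \<in> nil_core" "okubo_orth x y" for y
      proof -
        obtain s t where st: "y = nil_vec s t 0 0 0" using y by (auto simp: nil_core_def)
        then have "b * s + a * t = 0" using y orth_iff by blast
        then have "t = (s / a) * - b" using False
          by (simp add: field_simps eq_neg_iff_add_eq_0)
        then show ?thesis
          using False by (intro exI[of _ "s / a"]) (simp add: st nil_vec_lin)
      qed
    qed (use False nz in \<open>auto simp: nil_core_def\<close>)
  qed
qed

text \<open>Vanishing minors make the quadratic parts proportional; subtracting the multiple of
  \<open>x\<close> leaves a linear polynomial.\<close>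

lemma square_zero_orth_imp:
  fixes x y :: "'a::field ^ okubo_basis"
  assumes char: "CHAR('a) = 3" and x: "okubo_mult x x = 0" "x \<notin> nil_core"
    and y: "okubo_mult y y = 0" and orth: "okubo_orth x y"
  obtains t l where "l \<in> nil_core" "y = t *s x + l"
proof -
  obtain p q a b c where nx: "x = nil_vec p q a b c"
    using square_zero_imp_nil_vec[OF char x(1)] .
  obtain p' q' a' b' c' where ny: "y = nil_vec p' q' a' b' c'"
    using square_zero_imp_nil_vec[OF char y] .
  have nonzero: "a \<noteq> 0 \<or> b \<noteq> 0 \<or> c \<noteq> 0" using x(2) nx by (auto simp: nil_core_def)
  have ratio: "a * b' = b * a'" "c * a' = a * c'" "b * c' = c * b'"
    using orth nil_vec_eq_0_iff[OF char]
    by (auto simp: okubo_orth_def nx ny okubo_mult_nil_vec[OF char])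
  have "\<exists>t. a' = t * a \<and> b' = t * b \<and> c' = t * c"
  proof -
    consider "a \<noteq> 0" | "b \<noteq> 0" | "c \<noteq> 0" using nonzero by blast
    then show ?thesis
    proof cases
      case 1
      then show ?thesis using ratio by (intro exI[of _ "a' / a"]) (auto simp: field_simps)
    next
      case 2
      then show ?thesis using ratio by (intro exI[of _ "b' / b"]) (auto simp: field_simps)
    next
      case 3
      then show ?thesis using ratio by (intro exI[of _ "c' / c"]) (auto simp: field_simps)
    qed
  qed
  then obtain t where "a' = t * a" "b' = t * b" "c' = t * c" by blast
  then have "y = t *s x + nil_vec (p' - t * p) (q' - t * q) 0 0 0"
    by (simp add: nx ny nil_vec_lin)
  then show thesis by (intro that[of "nil_vec (p' - t * p) (q' - t * q) 0 0 0"])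
      (auto simp: nil_core_def)
qed

section \<open>Components of the orthogonality graph\<close>

lemma line_scale:
  assumes "c \<noteq> 0"
  shows "line (c *s x) = line x"
proof
  show "line (c *s x) \<subseteq> line x" by (auto simp: line_def vector_smult_assoc)
  have "d *s x = (d / c) *s (c *s x)" for d using assms by (simp add: vec_eq_iff)
  then show "line x \<subseteq> line (c *s x)" unfolding line_def by blast
qed

lemma line_eqE:
  assumes "line x = line y" "x \<noteq> 0"
  obtains c where "c \<noteq> 0" "x = c *s y"
proof -
  have "1 *s x \<in> line x" unfolding line_def by (rule rangeI)
  then have "x \<in> line y" using assms(1) by simp
  then show thesis using that assms(2) by (force simp: line_def)
qed

lemma line_neq_nil_core:
  assumes "x \<notin> nil_core" "l \<in> nil_core"
  shows "line x \<noteq> line l"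
proof
  assume eq: "line x = line l"
  have "x \<noteq> 0" using assms(1) by auto
  with eq obtain c where "x = c *s l" by (rule line_eqE)
  then show False using assms nil_core_scale by blast
qed

lemma line_neq_square_zero:
  assumes "okubo_mult x x \<noteq> 0" "okubo_mult y y = 0"
  shows "line x \<noteq> line y"
proof
  assume eq: "line x = line y"
  have "x \<noteq> 0" using assms(1) by auto
  with eq obtain c where "x = c *s y" by (rule line_eqE)
  then show False using assms by (simp add: okubo_mult_lin)
qed

text \<open>Orthogonality survives nonzero scaling, so any representatives of the two lines may be
  used.\<close>

lemma orthogonality_graph_arc_iff:
  assumes "x \<noteq> 0" "y \<noteq> 0"
  shows "(line x, line y) \<in> parcs (orthogonality_graph okubo_mult) \<longleftrightarrow>
    line x \<noteq> line y \<and> okubo_orth x y"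
proof
  assume "(line x, line y) \<in> parcs (orthogonality_graph okubo_mult)"
  then obtain a b where ab: "line x = line a" "line y = line b" "line x \<noteq> line y"
      "okubo_orth a b"
    unfolding orthogonality_graph_def okubo_orth_def by auto
  show "line x \<noteq> line y \<and> okubo_orth x y"
    using line_eqE[OF ab(1) assms(1)] line_eqE[OF ab(2) assms(2)] ab(3,4)
    by (metis okubo_orth_scale)
next
  assume "line x \<noteq> line y \<and> okubo_orth x y"
  then show "(line x, line y) \<in> parcs (orthogonality_graph okubo_mult)"
    using okubo_orth_imp_zero_divisor[of x y] okubo_orth_imp_zero_divisor[of y x] assms
    unfolding orthogonality_graph_def okubo_orth_def by auto
qed

lemma orthogonality_graph_arcE:
  assumes "(line x, w) \<in> parcs (orthogonality_graph okubo_mult)" "x \<noteq> 0"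
  obtains y where "w = line y" "y \<noteq> 0" "line x \<noteq> line y" "okubo_orth x y"
proof -
  obtain y where "w = line y" "y \<noteq> 0"
    using assms(1) by (auto simp: orthogonality_graph_def two_sided_zero_divisor_def)
  then show thesis using that assms orthogonality_graph_arc_iff by blast
qed

lemma orthogonality_graph_arc_square:
  assumes "(line x, w) \<in> parcs (orthogonality_graph okubo_mult)" "okubo_mult x x \<noteq> 0"
  shows "w = line (okubo_mult x x)"
proof -
  have "x \<noteq> 0" using assms(2) by auto
  then obtain y where y: "w = line y" "y \<noteq> 0" "okubo_orth x y"
    using orthogonality_graph_arcE[OF assms(1)] by blast
  obtain c where "y = c *s okubo_mult x x"
    using okubo_orth_square_unique[OF y(3) assms(2)] .
  then show ?thesis using y line_scale[of c] by auto
qed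

lemma orthogonality_graph_vertE:
  assumes "u \<in> pverts (orthogonality_graph okubo_mult)"
  obtains x where "u = line x" "x \<noteq> 0" "okubo_norm x = 0"
  using assms zero_divisor_norm that
  by (auto simp: orthogonality_graph_def two_sided_zero_divisor_def)

lemma orthogonality_graph_vertI:
  "okubo_orth x y \<Longrightarrow> x \<noteq> 0 \<Longrightarrow> y \<noteq> 0 \<Longrightarrow> line x \<in> pverts (orthogonality_graph okubo_mult)"
  using okubo_orth_imp_zero_divisor by (auto simp: orthogonality_graph_def)

lemma sym_parcs_orthogonality_graph: "sym (parcs (orthogonality_graph m))"
  by (auto simp: orthogonality_graph_def intro!: symI)

section \<open>The three layers of the large component\<close>

definition core_lines :: "('a::field ^ okubo_basis) set set" where
  "core_lines = {line x | x. x \<in> nil_core \<and> x \<noteq> 0}"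

definition square_zero_lines :: "('a::field ^ okubo_basis) set set" where
  "square_zero_lines = {line x | x. okubo_mult x x = 0 \<and> x \<notin> nil_core}"

definition pendant_lines :: "('a::field ^ okubo_basis) set set" where
  "pendant_lines = {line x | x. okubo_norm x = 0 \<and> okubo_mult x x \<noteq> 0 \<and>
     okubo_mult (okubo_mult x x) (okubo_mult x x) = 0}"

lemma core_lines_Un_square_zero_lines:
  assumes "CHAR('a::field) = 3"
  shows "core_lines \<union> square_zero_lines =
    {line x | x :: 'a ^ okubo_basis. okubo_mult x x = 0 \<and> x \<noteq> 0}"
  using nil_core_orth[OF assms] zero_in_nil_core
  by (auto simp: core_lines_def square_zero_lines_def okubo_orth_def)

lemma geodetic_core_lines:
  assumes "CHAR('a::field) = 3"
  shows "geodetic_on (parcs (orthogonality_graph okubo_mult))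
    (core_lines :: ('a ^ okubo_basis) set set)"
  using nil_core_orth[OF assms]
  by (intro geodetic_on_clique) (auto simp: core_lines_def orthogonality_graph_arc_iff)

text \<open>The difference \<open>y - t *s x\<close> lies in the core. It is orthogonal to both
  elements because they have square zero and are mutually orthogonal.\<close>

lemma common_core_neighbour:
  fixes x y :: "'a::field ^ okubo_basis"
  assumes char: "CHAR('a) = 3" and x: "okubo_mult x x = 0" "x \<notin> nil_core"
    and y: "okubo_mult y y = 0" "y \<notin> nil_core" and xy: "okubo_orth x y" "line x \<noteq> line y"
  obtains l t where "l \<in> nil_core" "l \<noteq> 0" "okubo_orth x l" "okubo_orth y l" "t \<noteq> 0"
    "y = t *s x + l"
proof -
  obtain t l where l: "l \<in> nil_core" "y = t *s x + l"
    using square_zero_orth_imp[OF char x y(1) xy(1)] .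
  have t: "t \<noteq> 0" using l y(2) by auto
  have "l \<noteq> 0" using l(2) xy(2) line_scale[OF t, of x] by force
  moreover have "l = y - t *s x" using l by simp
  then have "okubo_orth x l" "okubo_orth y l"
    using x y xy(1) by (simp_all add: okubo_orth_def okubo_mult_lin)
  ultimately show thesis using that l t by blast
qed

lemma geodetic_square_zero_lines:
  assumes char: "CHAR('a::field) = 3"
  shows "geodetic_on (parcs (orthogonality_graph okubo_mult))
    (core_lines \<union> square_zero_lines :: ('a ^ okubo_basis) set set)"
proof (rule geodetic_on_attach[OF geodetic_core_lines[OF char] _ sym_parcs_orthogonality_graph])
  show "core_lines \<inter> square_zero_lines = ({} :: ('a ^ okubo_basis) set set)"
    using line_neq_nil_core unfolding core_lines_def square_zero_lines_def by fastforce
next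
  fix u :: "('a ^ okubo_basis) set" assume "u \<in> square_zero_lines"
  then obtain x where x: "u = line x" "okubo_mult x x = 0" "x \<notin> nil_core"
    by (auto simp: square_zero_lines_def)
  then have x0: "x \<noteq> 0" by auto
  obtain l where l: "l \<in> nil_core" "l \<noteq> 0" "okubo_orth x l"
      "\<And>y. y \<in> nil_core \<Longrightarrow> okubo_orth x y \<Longrightarrow> \<exists>t. y = t *s l"
    using nil_core_neighbour[OF char x(2,3)] by blast
  show "\<exists>!p. p \<in> core_lines \<and> (u, p) \<in> parcs (orthogonality_graph okubo_mult)"
  proof (rule ex1I[of _ "line l"])
    have "line x \<noteq> line l" using l x line_neq_nil_core by blast
    then show "line l \<in> core_lines \<and> (u, line l) \<in> parcs (orthogonality_graph okubo_mult)"
      using l x x0 by (auto simp: core_lines_def orthogonality_graph_arc_iff)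
  next
    fix p assume p: "p \<in> core_lines \<and> (u, p) \<in> parcs (orthogonality_graph okubo_mult)"
    then obtain y where y: "p = line y" "y \<in> nil_core" "y \<noteq> 0" by (auto simp: core_lines_def)
    then have "okubo_orth x y" using p x x0 by (simp add: orthogonality_graph_arc_iff)
    then obtain t where t: "y = t *s l" using l y by blast
    then show "p = line l" using y line_scale[of t l] by auto
  qed
next
  fix u v :: "('a ^ okubo_basis) set"
  assume "u \<in> square_zero_lines" "v \<in> square_zero_lines"
    and uv: "(u, v) \<in> parcs (orthogonality_graph okubo_mult)"
  then obtain x y where x: "u = line x" "okubo_mult x x = 0" "x \<notin> nil_core"
      and y: "v = line y" "okubo_mult y y = 0" "y \<notin> nil_core"
    by (auto simp: square_zero_lines_def)
  then have nz: "x \<noteq> 0" "y \<noteq> 0" by auto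
  then have xy: "okubo_orth x y" "line x \<noteq> line y"
    using uv x y by (simp_all add: orthogonality_graph_arc_iff)
  obtain l where l: "l \<in> nil_core" "l \<noteq> 0" "okubo_orth x l" "okubo_orth y l"
    using common_core_neighbour[OF char x(2,3) y(2,3) xy] .
  have "line x \<noteq> line l" "line y \<noteq> line l" using l x y line_neq_nil_core by blast+
  then show "\<exists>p\<in>core_lines. (u, p) \<in> parcs (orthogonality_graph okubo_mult) \<and>
      (v, p) \<in> parcs (orthogonality_graph okubo_mult)"
    using l x y nz
    by (intro bexI[of _ "line l"]) (auto simp: core_lines_def orthogonality_graph_arc_iff)
next
  fix u v w :: "('a ^ okubo_basis) set"
  assume "u \<in> square_zero_lines" "v \<in> square_zero_lines" "w \<in> square_zero_lines"
    and uv: "(u, v) \<in> parcs (orthogonality_graph okubo_mult)"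
    and vw: "(v, w) \<in> parcs (orthogonality_graph okubo_mult)" and "u \<noteq> w"
  then obtain x y s where x: "u = line x" "okubo_mult x x = 0" "x \<notin> nil_core"
      and y: "v = line y" "okubo_mult y y = 0" "y \<notin> nil_core"
      and s: "w = line s" "okubo_mult s s = 0" "s \<notin> nil_core"
    by (auto simp: square_zero_lines_def)
  then have nz: "x \<noteq> 0" "y \<noteq> 0" "s \<noteq> 0" by auto
  then have xy: "okubo_orth y x" "line y \<noteq> line x" and ys: "okubo_orth y s" "line y \<noteq> line s"
    using uv vw x y s by (auto simp: orthogonality_graph_arc_iff okubo_orth_commute)
  obtain l t where l: "l \<in> nil_core" "okubo_orth y l" "okubo_orth x l" "x = t *s y + l" "l \<noteq> 0"
    using common_core_neighbour[OF char y(2,3) x(2,3) xy] .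
  obtain m t' where m: "m \<in> nil_core" "okubo_orth y m" "s = t' *s y + m"
    using common_core_neighbour[OF char y(2,3) s(2,3) ys] .
  \<comment> \<open>Both \<open>l\<close> and \<open>m\<close> are multiples of the one core
    direction \<open>k\<close> orthogonal to \<open>y\<close>. As \<open>l\<close> is nonzero,
    \<open>x\<close> is orthogonal to \<open>k\<close>, hence to \<open>m\<close> and to
    \<open>s\<close>.\<close>
  obtain k where k: "\<And>y'. y' \<in> nil_core \<Longrightarrow> okubo_orth y y' \<Longrightarrow> \<exists>t. y' = t *s k"
    using nil_core_neighbour[OF char y(2,3)] by metis
  obtain c d where "l = c *s k" "m = d *s k" using k l m by metis
  then have "okubo_orth x m" using l(3,5) by (cases "d = 0")
      (auto simp: okubo_orth_def okubo_mult_lin)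
  then have "okubo_orth x s"
    using xy by (simp add: m(3) okubo_orth_def okubo_mult_lin)
  then show "(u, w) \<in> parcs (orthogonality_graph okubo_mult)"
    using \<open>u \<noteq> w\<close> x s nz by (simp add: orthogonality_graph_arc_iff)
qed

lemma geodetic_pendant_lines:
  assumes char: "CHAR('a::field) = 3"
  shows "geodetic_on (parcs (orthogonality_graph okubo_mult))
    (core_lines \<union> square_zero_lines \<union> pendant_lines :: ('a ^ okubo_basis) set set)"
proof (rule geodetic_on_attach[OF geodetic_square_zero_lines[OF char] _
      sym_parcs_orthogonality_graph])
  show "(core_lines \<union> square_zero_lines) \<inter> pendant_lines = ({} :: ('a ^ okubo_basis) set set)"
    using line_neq_square_zero
    unfolding core_lines_Un_square_zero_lines[OF char] pendant_lines_def by fastforce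
  have parent: "\<exists>!p. p \<in> core_lines \<union> square_zero_lines \<and>
      (u, p) \<in> parcs (orthogonality_graph okubo_mult)"
    if u: "u \<in> pendant_lines" for u :: "('a ^ okubo_basis) set"
  proof -
    obtain x where x: "u = line x" "okubo_norm x = 0" "okubo_mult x x \<noteq> 0"
        "okubo_mult (okubo_mult x x) (okubo_mult x x) = 0"
      using u by (auto simp: pendant_lines_def)
    then have "x \<noteq> 0" "line x \<noteq> line (okubo_mult x x)" using x line_neq_square_zero by auto
    then show ?thesis
      using x okubo_orth_square[OF x(2)] orthogonality_graph_arc_square[of x]
      by (intro ex1I[of _ "line (okubo_mult x x)"])
        (auto simp: core_lines_Un_square_zero_lines[OF char] orthogonality_graph_arc_iff)
  qed
  then show "\<And>u. u \<in> pendant_lines \<Longrightarrow> \<exists>!p. p \<in> core_lines \<union> square_zero_lines \<and>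
      (u, p :: ('a ^ okubo_basis) set) \<in> parcs (orthogonality_graph okubo_mult)" .
  \<comment> \<open>The only possible neighbour is the line of \<open>x * x\<close>, which has
    square zero. The attached cliques are therefore single vertices.\<close>
  have no_arc: "(u, v) \<notin> parcs (orthogonality_graph okubo_mult)"
    if u: "u \<in> pendant_lines" and v: "v \<in> pendant_lines" for u v :: "('a ^ okubo_basis) set"
  proof
    assume uv: "(u, v) \<in> parcs (orthogonality_graph okubo_mult)"
    obtain x where x: "u = line x" "okubo_mult x x \<noteq> 0"
        "okubo_mult (okubo_mult x x) (okubo_mult x x) = 0"
      using u by (auto simp: pendant_lines_def)
    obtain y where y: "v = line y" "okubo_mult y y \<noteq> 0"
      using v by (auto simp: pendant_lines_def)
    show False
      using orthogonality_graph_arc_square[of x v] uv x y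
        line_neq_square_zero[of y "okubo_mult x x"] by simp
  qed
  then show "\<And>u v. u \<in> pendant_lines \<Longrightarrow> v \<in> pendant_lines \<Longrightarrow>
      (u, v :: ('a ^ okubo_basis) set) \<in> parcs (orthogonality_graph okubo_mult) \<Longrightarrow>
      \<exists>p\<in>core_lines \<union> square_zero_lines. (u, p) \<in> parcs (orthogonality_graph okubo_mult) \<and>
        (v, p) \<in> parcs (orthogonality_graph okubo_mult)"
    by blast
  show "\<And>u v w. u \<in> pendant_lines \<Longrightarrow> v \<in> pendant_lines \<Longrightarrow> w \<in> pendant_lines \<Longrightarrow>
      (u, v :: ('a ^ okubo_basis) set) \<in> parcs (orthogonality_graph okubo_mult) \<Longrightarrow>
      (v, w) \<in> parcs (orthogonality_graph okubo_mult) \<Longrightarrow> u \<noteq> w \<Longrightarrow>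
      (u, w) \<in> parcs (orthogonality_graph okubo_mult)"
    using no_arc by blast
qed

theorem corollary4p17:
  fixes u v :: "('a::field ^ okubo_basis) set" and k :: nat
  assumes "CHAR('a) = 3"
    and "u \<in> pverts (orthogonality_graph okubo_mult)"
    and "v \<in> pverts (orthogonality_graph okubo_mult)"
    and "graph_distance (orthogonality_graph okubo_mult) u v = ereal (real k)"
  shows "\<exists>!p. path_of_length (orthogonality_graph okubo_mult) u v k p"
proof -
  let ?G = "orthogonality_graph okubo_mult :: ('a ^ okubo_basis) set pair_pre_digraph"
  obtain x where x: "u = line x" "x \<noteq> 0" "okubo_norm x = 0"
    using orthogonality_graph_vertE[OF assms(2)] .
  define s where "s = okubo_mult x x"
  show ?thesis
  proof (cases "okubo_mult s s = 0")
    case False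
    then have s0: "s \<noteq> 0" by auto
    have ss: "okubo_mult s s = okubo_polar s x *s x"
      unfolding s_def by (rule okubo_square_square[OF x(3)])
    have orth: "okubo_orth x s" unfolding s_def by (rule okubo_orth_square[OF x(3)])
    \<comment> \<open>Since \<open>s * s\<close> is a nonzero multiple of \<open>x\<close>, the only
      possible neighbour of \<open>line s\<close> is \<open>line x\<close>.\<close>
    have closed: "w \<in> {line x, line s}"
      if "y \<in> {line x, line s}" "(y, w) \<in> parcs ?G" for y w
      using that orthogonality_graph_arc_square[of x w] orthogonality_graph_arc_square[of s w]
        False s0 ss line_scale[of "okubo_polar s x" x]
      by (auto simp flip: s_def)
    have "geodetic_on (parcs ?G) {line x, line s}"
      using orth x(2) s0
      by (intro geodetic_on_clique) (auto simp: orthogonality_graph_arc_iff okubo_orth_commute)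
    moreover have "{line x, line s} \<subseteq> pverts ?G"
      using orthogonality_graph_vertI orth x(2) s0 okubo_orth_commute by blast
    ultimately show ?thesis
      using closed assms(4) x(1)
      by (intro ex1_path_of_length[OF wf_orthogonality_graph, of _ "{line x, line s}"]) auto
  next
    case True
    let ?V = "core_lines \<union> square_zero_lines \<union> pendant_lines :: ('a ^ okubo_basis) set set"
    have in_V: "line y \<in> ?V"
      if "y \<noteq> 0" "okubo_norm y = 0" "okubo_mult (okubo_mult y y) (okubo_mult y y) = 0" for y
      using that core_lines_Un_square_zero_lines[OF assms(1)] by (auto simp: pendant_lines_def)
    have V_cases: "\<exists>y. w = line y \<and> y \<noteq> 0 \<and> okubo_norm y = 0 \<and>
        okubo_mult (okubo_mult y y) (okubo_mult y y) = 0" if w: "w \<in> ?V" for w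
    proof -
      consider y where "w = line y" "okubo_mult y y = 0" "y \<noteq> 0"
        | y where "w = line y" "okubo_norm y = 0" "okubo_mult y y \<noteq> 0"
          "okubo_mult (okubo_mult y y) (okubo_mult y y) = 0"
        using w core_lines_Un_square_zero_lines[OF assms(1)] by (auto simp: pendant_lines_def)
      then show ?thesis
      proof cases
        case 1
        then show ?thesis using okubo_alternative(1)[of y y] by (intro exI[of _ y]) simp
      next
        case 2
        then show ?thesis by (intro exI[of _ y]) auto
      qed
    qed
    have "?V \<subseteq> pverts ?G"
    proof
      fix w assume "w \<in> ?V"
      then obtain y where y: "w = line y" "y \<noteq> 0" "okubo_norm y = 0"
        using V_cases by blast
      \<comment> \<open>The square of \<open>y\<close> witnesses the zero divisor if it is nonzero,
        otherwise \<open>y\<close> itself does.\<close>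
      then show "w \<in> pverts ?G"
        using orthogonality_graph_vertI[of y "okubo_mult y y"] orthogonality_graph_vertI[of y y]
          okubo_orth_square[of y]
        by (cases "okubo_mult y y = 0") (auto simp: okubo_orth_def)
    qed
    moreover have "w \<in> ?V" if v: "v \<in> ?V" and arc: "(v, w) \<in> parcs ?G" for v w
    proof -
      obtain y where y: "v = line y" "y \<noteq> 0" "okubo_norm y = 0"
          "okubo_mult (okubo_mult y y) (okubo_mult y y) = 0"
        using V_cases[OF v] by blast
      obtain t where t: "w = line t" "t \<noteq> 0" "okubo_orth y t"
        using orthogonality_graph_arcE[of y w] arc y by blast
      have "okubo_norm t = 0"
        using okubo_orth_imp_zero_divisor[of t y] zero_divisor_norm t y okubo_orth_commute by blast
      moreover have "okubo_mult (okubo_mult t t) (okubo_mult t t) = 0"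
      \<comment> \<open>If \<open>t * t\<close> is nonzero, \<open>y\<close> is a multiple of it.
        Were \<open>y * y\<close> nonzero too, \<open>t\<close> would be a multiple of
        \<open>y * y\<close> and have square zero. So \<open>y * y = 0\<close>, which carries over
        to \<open>t * t\<close>.\<close>
      proof (cases "okubo_mult t t = 0")
        case False
        obtain c where c: "y = c *s okubo_mult t t"
          using okubo_orth_square_unique[of t y] False t okubo_orth_commute by blast
        obtain d where d: "t = d *s okubo_mult y y" if "okubo_mult y y \<noteq> 0"
          using okubo_orth_square_unique[of y t] t by blast
        have "okubo_mult y y = 0"
          using False d y(4) by (cases "okubo_mult y y = 0") (simp_all add: okubo_mult_lin)
        then show ?thesis using c y(2) by (auto simp: okubo_mult_lin)
      qed simp
      ultimately show ?thesis using in_V t by simp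
    qed
    moreover have "u \<in> ?V" using in_V[of x] x True by (simp add: s_def)
    ultimately show ?thesis
      by (intro ex1_path_of_length[OF wf_orthogonality_graph geodetic_pendant_lines[OF assms(1)]]
          assms(4))
  qed
qed

end
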